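(* Assume $\nu$ is a probability measure. Let $\Omega$ be a $\nu$-measurable subset of $X$ such that $0<\nu(\Omega)\le\frac12$. (i) If $\Omega$ and $X\setminus\Omega$ are $m$-calibrable, then $\left(\lambda_\Omega^m,\frac1{\nu(\Omega)}\chi_\Omega\right)$ is an $m$-eigenpair of $\Delta_1^m$. (ii) If $h_m(X)=\lambda_\Omega^m$, then $\Omega$ and $X\setminus\Omega$ are $m$-calibrable. (iii) If $h_m(X)=\lambda_\Omega^m$, then $\left(\lambda_\Omega^m,\frac1{\nu(\Omega)}\chi_\Omega\right)$ is an $m$-eigenpair of $\Delta_1^m$.
   Context: Metric random walk space: $(X,d)$ is a Polish metric space with its Borel $\sigma$-algebra and $m=(m_x)_{x\in X}$ is a family of Borel probability measures on $X$ such that $x\mapsto m_x(A)$ is Borel for every Borel set $A$, and each $m_x$ has finite first moment ($\int_X d(z,y)\,dm_x(y)<\infty$ for some, hence every, $z\in X$). $\nu$ is a Radon probability measure on $X$ that is invariant, $\nu(A)=\int_X m_x(A)\,d\nu(x)$, and reversible for $m$: for every Borel $C\subset X\times X$, $\int_X\int_X\chi_C(x,y)\,dm_x(y)d\nu(x)=\int_X\int_X\chi_C(x,y)\,dm_y(x)d\nu(y)$. Put $L_m(A,B)=\int_A\int_B dm_x(y)d\nu(x)$; the space is assumed $m$-connected: $L_m(A,B)>0$ for any $\nu$-measurable sets $A,B$ of positive $\nu$-measure with $A\cup B=X$. $P_m(E)=L_m(E,X\setminus E)$ and, for $\nu$-measurable $D$ with $0<\nu(D)<1$, $\lambda_D^m:=\frac{P_m(D)}{\nu(D)}$.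 Such a $D$ is $m$-calibrable if $\lambda_D^m=\inf\left\{\frac{P_m(E)}{\nu(E)}: E\subset D \ \nu\text{-measurable},\ \nu(E)>0\right\}$. The $m$-Cheeger constant of $X$ is $h_m(X)=\inf\left\{\frac{P_m(D)}{\nu(D)}: D\subset X \ \nu\text{-measurable},\ 0<\nu(D)\le\frac12\right\}$. For $\nu$-measurable $u$, $TV_m(u)=\frac12\int_X\int_X|u(y)-u(x)|\,dm_x(y)d\nu(x)$; $\mathcal F_m:L^2(X,\nu)\to[0,+\infty]$, $\mathcal F_m(u)=TV_m(u)$. $w\in\partial\mathcal F_m(u)$ iff $\mathcal F_m(u)<\infty$ and $\mathcal F_m(z)\ge\mathcal F_m(u)+\int_X w(z-u)\,d\nu$ for all $z\in L^2(X,\nu)$; $v\in\Delta_1^m u$ iff $-v\in\partial\mathcal F_m(u)$. Multivalued sign: $\mathrm{sign}(r)=1$ if $r>0$, $[-1,1]$ if $r=0$, $-1$ if $r<0$. A pair $(\lambda,u)\in\mathbb R\times L^2(X,\nu)$ is an $m$-eigenpair of $\Delta_1^m$ if $\|u\|_{L^1(X,\nu)}=1$ and there is a function $\xi$ with $\xi(x)\in\mathrm{sign}(u(x))$ such that $\lambda\xi\in\partial\mathcal F_m(u)=-\Delta_1^m u$. *)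

theory Defs
  imports "HOL-Probability.Probability"
begin

text \<open>
  The space \<open>X\<close> is a type of class \<^class>\<open>polish_space\<close> (a complete separable metric space).
  The \<open>\<nu>\<close>-measurable sets are the elements of \<open>sets (completion \<nu>)\<close>. If \<open>\<nu>\<close> is invariant, such a
  set belongs to \<open>sets (completion (m x))\<close> for \<open>\<nu>\<close>-almost every \<open>x\<close> only; this is why the measures
  \<open>m x\<close> are completed as well in \<open>m_interaction\<close> and \<open>m_TV\<close>.
\<close>

locale metric_random_walk =
  fixes m :: "'a::polish_space \<Rightarrow> 'a measure"
  assumes prob_space_m: "\<And>x. prob_space (m x)"
    and sets_m: "\<And>x. sets (m x) = sets borel"
    and measurable_m: "\<And>A. A \<in> sets borel \<Longrightarrow> (\<lambda>x. measure (m x) A) \<in> borel_measurable borel"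
    and first_moment: "\<And>x. \<exists>z. integrable (m x) (\<lambda>y. dist z y)"

definition radon_prob :: "'a::polish_space measure \<Rightarrow> bool" where
  "radon_prob \<nu> \<longleftrightarrow> prob_space \<nu> \<and> sets \<nu> = sets borel \<and>
     (\<forall>B\<in>sets borel. emeasure \<nu> B = (SUP K\<in>{K. K \<subseteq> B \<and> compact K}. emeasure \<nu> K))"

definition m_invariant :: "('a::polish_space \<Rightarrow> 'a measure) \<Rightarrow> 'a measure \<Rightarrow> bool" where
  "m_invariant m \<nu> \<longleftrightarrow>
     (\<forall>A\<in>sets borel. emeasure \<nu> A = (\<integral>\<^sup>+x. emeasure (m x) A \<partial>\<nu>))"

definition m_reversible :: "('a::polish_space \<Rightarrow> 'a measure) \<Rightarrow> 'a measure \<Rightarrow> bool" where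
  "m_reversible m \<nu> \<longleftrightarrow> (\<forall>C\<in>sets (borel :: ('a \<times> 'a) measure).
     (\<integral>\<^sup>+x. (\<integral>\<^sup>+y. indicator C (x, y) \<partial>m x) \<partial>\<nu>) = (\<integral>\<^sup>+y. (\<integral>\<^sup>+x. indicator C (x, y) \<partial>m y) \<partial>\<nu>))"

definition m_interaction ::
  "('a::polish_space \<Rightarrow> 'a measure) \<Rightarrow> 'a measure \<Rightarrow> 'a set \<Rightarrow> 'a set \<Rightarrow> real" where
  "m_interaction m \<nu> A B = (LINT x:A|completion \<nu>. measure (completion (m x)) B)"

definition m_connected :: "('a::polish_space \<Rightarrow> 'a measure) \<Rightarrow> 'a measure \<Rightarrow> bool" where
  "m_connected m \<nu> \<longleftrightarrow>
     (\<forall>A\<in>sets (completion \<nu>). \<forall>B\<in>sets (completion \<nu>).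
        measure (completion \<nu>) A > 0 \<longrightarrow> measure (completion \<nu>) B > 0 \<longrightarrow> A \<union> B = UNIV \<longrightarrow>
        m_interaction m \<nu> A B > 0)"

locale reversible_random_walk = metric_random_walk m
  for m :: "'a::polish_space \<Rightarrow> 'a measure" +
  fixes \<nu> :: "'a measure"
  assumes radon: "radon_prob \<nu>"
    and invariant: "m_invariant m \<nu>"
    and reversible: "m_reversible m \<nu>"
    and connected: "m_connected m \<nu>"

definition m_perimeter ::
  "('a::polish_space \<Rightarrow> 'a measure) \<Rightarrow> 'a measure \<Rightarrow> 'a set \<Rightarrow> real" where
  "m_perimeter m \<nu> E = m_interaction m \<nu> E (- E)"

definition m_ratio ::
  "('a::polish_space \<Rightarrow> 'a measure) \<Rightarrow> 'a measure \<Rightarrow> 'a set \<Rightarrow> real" where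
  "m_ratio m \<nu> D = m_perimeter m \<nu> D / measure (completion \<nu>) D"

definition m_calibrable ::
  "('a::polish_space \<Rightarrow> 'a measure) \<Rightarrow> 'a measure \<Rightarrow> 'a set \<Rightarrow> bool" where
  "m_calibrable m \<nu> D \<longleftrightarrow>
     D \<in> sets (completion \<nu>) \<and> 0 < measure (completion \<nu>) D \<and> measure (completion \<nu>) D < 1 \<and>
     m_ratio m \<nu> D =
       Inf {m_perimeter m \<nu> E / measure (completion \<nu>) E | E.
              E \<subseteq> D \<and> E \<in> sets (completion \<nu>) \<and> measure (completion \<nu>) E > 0}"

definition m_cheeger :: "('a::polish_space \<Rightarrow> 'a measure) \<Rightarrow> 'a measure \<Rightarrow> real" where
  "m_cheeger m \<nu> =
     Inf {m_perimeter m \<nu> D / measure (completion \<nu>) D | D.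
            D \<in> sets (completion \<nu>) \<and>
            0 < measure (completion \<nu>) D \<and> measure (completion \<nu>) D \<le> 1 / 2}"

definition m_TV ::
  "('a::polish_space \<Rightarrow> 'a measure) \<Rightarrow> 'a measure \<Rightarrow> ('a \<Rightarrow> real) \<Rightarrow> ennreal" where
  "m_TV m \<nu> u =
     (\<integral>\<^sup>+x. (\<integral>\<^sup>+y. ennreal \<bar>u y - u x\<bar> \<partial>completion (m x)) \<partial>completion \<nu>) / 2"

text \<open>
  Elements of \<open>L\<^sup>2(X, \<nu>)\<close> are represented by functions; everything below except the pointwise
  sign condition depends on a function only up to \<open>\<nu>\<close>-null sets, and the selection \<open>\<xi>\<close> in that
  condition may itself be changed on a null set.
\<close>

definition L2_fun :: "'a::polish_space measure \<Rightarrow> ('a \<Rightarrow> real) set" where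
  "L2_fun \<nu> =
     {u. u \<in> borel_measurable (completion \<nu>) \<and> integrable (completion \<nu>) (\<lambda>x. (u x)\<^sup>2)}"

text \<open>The functional \<open>\<F>\<^sub>m\<close> is \<open>m_TV m \<nu>\<close> restricted to \<open>L2_fun \<nu>\<close>.\<close>

definition m_subdiff ::
  "('a::polish_space \<Rightarrow> 'a measure) \<Rightarrow> 'a measure \<Rightarrow> ('a \<Rightarrow> real) \<Rightarrow> ('a \<Rightarrow> real) set" where
  "m_subdiff m \<nu> u = {w. u \<in> L2_fun \<nu> \<and> w \<in> L2_fun \<nu> \<and> m_TV m \<nu> u < \<infinity> \<and>
     (\<forall>z\<in>L2_fun \<nu>. enn2ereal (m_TV m \<nu> z) \<ge>
        enn2ereal (m_TV m \<nu> u) + ereal (LINT x|completion \<nu>. w x * (z x - u x)))}"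

definition m_laplace1 ::
  "('a::polish_space \<Rightarrow> 'a measure) \<Rightarrow> 'a measure \<Rightarrow> ('a \<Rightarrow> real) \<Rightarrow> ('a \<Rightarrow> real) set" where
  "m_laplace1 m \<nu> u = {v. (\<lambda>x. - v x) \<in> m_subdiff m \<nu> u}"

definition multi_sign :: "real \<Rightarrow> real set" where
  "multi_sign r = (if r > 0 then {1} else if r = 0 then {-1..1} else {-1})"

definition m_eigenpair ::
  "('a::polish_space \<Rightarrow> 'a measure) \<Rightarrow> 'a measure \<Rightarrow> real \<Rightarrow> ('a \<Rightarrow> real) \<Rightarrow> bool" where
  "m_eigenpair m \<nu> l u \<longleftrightarrow>
     u \<in> L2_fun \<nu> \<and> (LINT x|completion \<nu>. \<bar>u x\<bar>) = 1 \<and>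
     (\<exists>\<xi>. (\<forall>x. \<xi> x \<in> multi_sign (u x)) \<and> (\<lambda>x. - (l * \<xi> x)) \<in> m_laplace1 m \<nu> u)"

end

theory Submission
  imports Defs
begin

text \<open>
  Write \<open>P\<close> for the perimeter, \<open>\<lambda> = P(\<Omega>)/\<nu>(\<Omega>)\<close> and \<open>\<lambda>' = P(-\<Omega>)/\<nu>(-\<Omega>)\<close> for the ratios of \<open>\<Omega>\<close> and
  its complement. Since the total variation does not see constants, every subgradient has mean zero;
  this dictates the simplest candidate, \<open>\<xi> = 1\<close> on \<open>\<Omega>\<close> and \<open>\<xi> = - \<nu>(\<Omega>)/\<nu>(-\<Omega>)\<close> off \<open>\<Omega>\<close>. Its values lie in
  \<open>[-1, 1]\<close> exactly because \<open>\<nu>(\<Omega>) \<le> 1/2\<close>, and \<open>P(-\<Omega>) = P(\<Omega>)\<close> (reversibility) turns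
  \<open>w = \<lambda> \<xi>\<close> into \<open>\<lambda>\<close> on \<open>\<Omega>\<close> and \<open>-\<lambda>'\<close> off \<open>\<Omega>\<close>.

  For \<open>u = \<chi>\<^sub>\<Omega>/\<nu>(\<Omega>)\<close> one has \<open>\<integral> w u d\<nu> = \<lambda> = TV(u)\<close>, so \<open>w\<close> is a subgradient at \<open>u\<close> as soon as
  \<open>\<integral> w z d\<nu> \<le> TV(z)\<close> for all \<open>z\<close>. Both sides are integrals over the level sets of \<open>z\<close>: the right one
  by the coarea formula (\<open>coarea\<close>), the left one by the layer cake formula (\<open>signed_layer_cake\<close>),
  which needs no correction for negative levels because \<open>w\<close> has mean zero. It therefore suffices that
  \<open>\<integral>\<^sub>E w d\<nu> \<le> P(E)\<close> for all sets \<open>E\<close>. Here calibrability of \<open>\<Omega>\<close> bounds \<open>P(E \<inter> \<Omega>)\<close> from below,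
  calibrability of \<open>-\<Omega>\<close> bounds \<open>P(-(E \<union> \<Omega>)) = P(E \<union> \<Omega>)\<close> from below, and submodularity
  \<open>P(E \<inter> \<Omega>) + P(E \<union> \<Omega>) \<le> P(E) + P(\<Omega>)\<close> combines the two (\<open>calibrable_weight_le_perimeter\<close>).

  If \<open>\<Omega>\<close> attains the Cheeger constant, subsets of \<open>\<Omega>\<close> and of \<open>-\<Omega>\<close> of measure at most \<open>1/2\<close> have
  a ratio at least \<open>\<lambda> \<ge> \<lambda>'\<close>; for a larger subset \<open>E\<close> of \<open>-\<Omega>\<close> the Cheeger inequality is applied to
  \<open>-E\<close>, which contains \<open>\<Omega>\<close> (\<open>cheeger_set_calibrable\<close>). So both sets are calibrable, and the
  third claim follows from the first two.

  Perimeter and total variation are both read off the edge measure \<open>\<gamma>(dx, dy) = m\<^sub>x(dy) \<nu>(dx)\<close> on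
  \<open>X \<times> X\<close>. Sets and functions that are only \<open>\<nu>\<close>-measurable are first replaced by Borel ones; invariance
  of \<open>\<nu>\<close> makes the replacement harmless for \<open>m\<^sub>x\<close> too, for almost every \<open>x\<close>.
\<close>

section \<open>Completed measures\<close>

lemma (in complete_measure) borel_measurable_AE_cong:
  fixes f g :: "'a \<Rightarrow> 'b::topological_space"
  assumes "g \<in> borel_measurable M" "AE x in M. f x = g x"
  shows "f \<in> borel_measurable M"
proof (rule measurableI)
  fix S :: "'b set" assume S: "S \<in> sets borel"
  show "f -` S \<inter> space M \<in> sets M"
  proof (rule in_sets_AE)
    show "AE x in M. x \<in> g -` S \<inter> space M \<longleftrightarrow> x \<in> f -` S \<inter> space M"
      using assms(2) by eventually_elim auto
  qed (use assms(1) S in \<open>auto intro: measurable_sets\<close>)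
qed auto

lemma L2_fun_integrable:
  assumes "prob_space \<nu>" "z \<in> L2_fun \<nu>"
  shows "integrable (completion \<nu>) z"
proof -
  interpret prob_space "completion \<nu>"
    using assms(1) by (rule prob_space.prob_space_completion)
  show ?thesis
    using assms(2) unfolding L2_fun_def by (auto intro: square_integrable_imp_integrable)
qed

lemma ennreal_double_half: "2 * e / 2 = e" for e :: ennreal
  unfolding mult.commute[of 2 e] by (rule ennreal_mult_divide_eq) simp_all

lemma emeasure_lborel_Ico_eq: "emeasure lborel {l..<u} = ennreal (u - l)" for l u :: real
  by (cases "l \<le> u") (auto simp: ennreal_neg)

lemma measure_lborel_Ico_eq: "measure lborel {l..<u} = max 0 (u - l)" for l u :: real
  by (cases "l \<le> u") (auto simp: measure_def)

section \<open>Signed layer cake formula\<close>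

text \<open>
  Integrate the identity \<open>z x = \<integral> ([0 \<le> t < z x] - [z x \<le> t < 0]) dt\<close> against \<open>w\<close> and exchange the
  integrals. The inner integrand is \<open>[t < z x] - [t < 0]\<close>; the second bracket is independent of \<open>x\<close> and
  disappears because \<open>w\<close> has mean zero.
\<close>

lemma signed_layer_cake:
  fixes w z :: "'a \<Rightarrow> real"
  assumes M: "finite_measure M" and z: "integrable M z"
    and w[measurable]: "w \<in> borel_measurable M" and bound: "\<And>x. \<bar>w x\<bar> \<le> C"
    and mean: "(\<integral>x. w x \<partial>M) = 0"
  shows "integrable lborel (\<lambda>t. \<integral>x. w x * indicator {x. t < z x} x \<partial>M)"
    and "(\<integral>t. (\<integral>x. w x * indicator {x. t < z x} x \<partial>M) \<partial>lborel) = (\<integral>x. w x * z x \<partial>M)"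
proof -
  interpret finite_measure M by (rule M)
  interpret P: pair_sigma_finite M "lborel :: real measure" ..
  have zm[measurable]: "z \<in> borel_measurable M" using z by simp
  define k :: "'a \<Rightarrow> real \<Rightarrow> real"
    where "k x t = indicator {0..<z x} t - indicator {z x..<0} t" for x t
  have k_alt: "k x t = of_bool (t < z x) - of_bool (t < 0)" for x t
    by (auto simp: k_def indicator_def)
  have k_abs: "\<bar>k x t\<bar> = indicator {0..<z x} t + indicator {z x..<0} t" for x t
    by (auto simp: k_def indicator_def)
  have k_int: "integrable lborel (k x)" for x
    unfolding k_def by (intro Bochner_Integration.integrable_diff integrable_real_indicator)
      (auto simp: emeasure_lborel_Ico_eq)
  have k_eq: "(\<integral>t. k x t \<partial>lborel) = z x" for x
    unfolding k_def
    by (subst Bochner_Integration.integral_diff)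
      (auto intro!: integrable_real_indicator simp: emeasure_lborel_Ico_eq measure_lborel_Ico_eq)
  have k_abs_eq: "(\<integral>t. \<bar>k x t\<bar> \<partial>lborel) = \<bar>z x\<bar>" for x
    unfolding k_abs
    by (subst Bochner_Integration.integral_add)
      (auto intro!: integrable_real_indicator simp: emeasure_lborel_Ico_eq measure_lborel_Ico_eq)
  have wi: "integrable M w"
    by (rule integrable_const_bound[of _ C]) (use bound in auto)
  have wz: "integrable M (\<lambda>x. \<bar>w x\<bar> * \<bar>z x\<bar>)"
    by (rule Bochner_Integration.integrable_bound[of _ "\<lambda>x. C * z x"])
      (use z bound in \<open>auto simp: abs_mult intro!: mult_right_mono order_trans[OF bound abs_ge_self]\<close>)
  have int: "integrable (M \<Otimes>\<^sub>M lborel) (case_prod (\<lambda>x t. w x * k x t))"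
  proof (rule P.Fubini_integrable)
    show "case_prod (\<lambda>x t. w x * k x t) \<in> borel_measurable (M \<Otimes>\<^sub>M lborel)"
      unfolding k_alt by measurable
    show "integrable M (\<lambda>x. \<integral>t. norm (case (x, t) of (x, t) \<Rightarrow> w x * k x t) \<partial>lborel)"
      using wz by (simp add: abs_mult k_abs_eq)
    show "AE x in M. integrable lborel (\<lambda>t. case (x, t) of (x, t) \<Rightarrow> w x * k x t)"
      using k_int by simp
  qed
  have inner: "(\<integral>x. w x * k x t \<partial>M) = (\<integral>x. w x * indicator {x. t < z x} x \<partial>M)" for t
  proof -
    have *: "w x * k x t = w x * indicator {x. t < z x} x - w x * of_bool (t < 0)" for x
      by (auto simp: k_alt indicator_def)
    have "integrable M (\<lambda>x. w x * indicator {x. t < z x} x)"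
      by (rule integrable_const_bound[of _ C])
        (use bound order_trans[OF abs_ge_zero bound] in \<open>auto simp: indicator_def\<close>)
    then show ?thesis
      unfolding * using wi mean by (subst Bochner_Integration.integral_diff) auto
  qed
  show "integrable lborel (\<lambda>t. \<integral>x. w x * indicator {x. t < z x} x \<partial>M)"
    using P.integrable_snd[OF int] by (simp add: inner)
  show "(\<integral>t. (\<integral>x. w x * indicator {x. t < z x} x \<partial>M) \<partial>lborel) = (\<integral>x. w x * z x \<partial>M)"
    using P.Fubini_integral[OF int] by (simp add: inner k_eq)
qed

lemma integral_le_nn_integral:
  fixes f :: "'a \<Rightarrow> real"
  assumes "integrable M f"
  shows "ennreal (\<integral>x. f x \<partial>M) \<le> (\<integral>\<^sup>+x. ennreal (f x) \<partial>M)"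
proof -
  have fin: "(\<integral>\<^sup>+x. ennreal (f x) \<partial>M) < \<infinity>"
    using assms by (auto simp: real_integrable_def less_top)
  have "(\<integral>x. f x \<partial>M) \<le> enn2real (\<integral>\<^sup>+x. ennreal (f x) \<partial>M)"
    using assms by (simp add: real_lebesgue_integral_def)
  then have "ennreal (\<integral>x. f x \<partial>M) \<le> ennreal (enn2real (\<integral>\<^sup>+x. ennreal (f x) \<partial>M))"
    by (rule ennreal_leI)
  also have "\<dots> = (\<integral>\<^sup>+x. ennreal (f x) \<partial>M)"
    using fin by (intro ennreal_enn2real) simp
  finally show ?thesis .
qed

section \<open>The edge measure of a random walk\<close>

text \<open>
  This is the law of one step \<open>(x, y)\<close> of the walk started from \<open>\<nu>\<close>. As a single finite measure it
  allows the double integral over \<open>m\<^sub>x\<close> and \<open>\<nu>\<close> to be exchanged with an integral over levels in one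
  application of Fubini's theorem.
\<close>

definition edge_measure :: "('a::polish_space \<Rightarrow> 'a measure) \<Rightarrow> 'a measure \<Rightarrow> ('a \<times> 'a) measure" where
  "edge_measure m \<nu> = \<nu> \<bind> (\<lambda>x. distr (m x) (borel \<Otimes>\<^sub>M borel) (Pair x))"

context reversible_random_walk
begin

abbreviation "\<gamma> \<equiv> edge_measure m \<nu>"

lemma prob_\<nu>: "prob_space \<nu>" and sets_\<nu>: "sets \<nu> = sets borel"
  using radon by (auto simp: radon_prob_def)

lemma space_\<nu>: "space \<nu> = UNIV" and space_m: "space (m x) = UNIV"
  using sets_eq_imp_space_eq[OF sets_\<nu>] sets_eq_imp_space_eq[OF sets_m] by auto

lemma prob_completion: "prob_space (completion \<nu>)"
  by (rule prob_space.prob_space_completion[OF prob_\<nu>])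

lemma kernel_measurable: "m \<in> borel \<rightarrow>\<^sub>M subprob_algebra borel"
proof (rule measurable_subprob_algebra)
  fix x show "subprob_space (m x)"
    by (rule prob_space_imp_subprob_space[OF prob_space_m])
  fix A :: "'a set" assume A: "A \<in> sets borel"
  have "(\<lambda>x. ennreal (measure (m x) A)) \<in> borel_measurable borel"
    using measurable_m[OF A] by measurable
  moreover have "emeasure (m x) A = ennreal (measure (m x) A)" for x
    using prob_space_m by (intro finite_measure.emeasure_eq_measure) (simp add: prob_space_def)
  ultimately show "(\<lambda>x. emeasure (m x) A) \<in> borel_measurable borel"
    by simp
qed (rule sets_m)

lemma edge_kernel_measurable:
  "(\<lambda>x. distr (m x) (borel \<Otimes>\<^sub>M borel) (Pair x)) \<in> \<nu> \<rightarrow>\<^sub>M subprob_algebra (borel \<Otimes>\<^sub>M borel)"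
proof -
  have "(\<lambda>x. distr (m x) (borel \<Otimes>\<^sub>M borel) (Pair x)) \<in> borel \<rightarrow>\<^sub>M subprob_algebra (borel \<Otimes>\<^sub>M borel)"
    by (rule measurable_distr2[OF _ kernel_measurable]) simp
  then show ?thesis by (simp cong: measurable_cong_sets add: sets_\<nu>)
qed

lemma sets_\<gamma>: "sets \<gamma> = sets (borel \<Otimes>\<^sub>M borel)"
  unfolding edge_measure_def
  by (rule sets_bind[OF _ ]) (auto simp: space_\<nu>)

lemma nn_integral_\<gamma>:
  assumes f[measurable]: "f \<in> borel_measurable (borel \<Otimes>\<^sub>M borel)"
  shows "(\<integral>\<^sup>+p. f p \<partial>\<gamma>) = (\<integral>\<^sup>+x. \<integral>\<^sup>+y. f (x, y) \<partial>m x \<partial>\<nu>)"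
proof -
  have Pair: "Pair x \<in> m x \<rightarrow>\<^sub>M borel \<Otimes>\<^sub>M borel" for x :: 'a
    by (simp cong: measurable_cong_sets add: sets_m)
  show ?thesis
    unfolding edge_measure_def nn_integral_bind[OF f edge_kernel_measurable]
    by (intro nn_integral_cong nn_integral_distr Pair) simp
qed

lemma emeasure_\<gamma>_rectangle:
  assumes A: "A \<in> sets borel" and B: "B \<in> sets borel"
  shows "emeasure \<gamma> (A \<times> B) = (\<integral>\<^sup>+x. indicator A x * emeasure (m x) B \<partial>\<nu>)"
proof -
  have AB: "A \<times> B \<in> sets (borel \<Otimes>\<^sub>M borel)" using A B by simp
  have "emeasure \<gamma> (A \<times> B) = (\<integral>\<^sup>+p. indicator (A \<times> B) p \<partial>\<gamma>)"
    using AB by (simp add: sets_\<gamma>)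
  also have "\<dots> = (\<integral>\<^sup>+x. \<integral>\<^sup>+y. indicator (A \<times> B) (x, y) \<partial>m x \<partial>\<nu>)"
    by (rule nn_integral_\<gamma>) (use AB in simp)
  also have "\<dots> = (\<integral>\<^sup>+x. indicator A x * emeasure (m x) B \<partial>\<nu>)"
  proof (rule nn_integral_cong)
    fix x
    have "(\<integral>\<^sup>+y. indicator (A \<times> B) (x, y) \<partial>m x) = (\<integral>\<^sup>+y. indicator A x * indicator B y \<partial>m x)"
      by (intro nn_integral_cong) (auto simp: indicator_def)
    also have "\<dots> = indicator A x * emeasure (m x) B"
      using B by (subst nn_integral_cmult) (auto simp: sets_m intro!: borel_measurable_indicator)
    finally show "(\<integral>\<^sup>+y. indicator (A \<times> B) (x, y) \<partial>m x) = indicator A x * emeasure (m x) B" .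
  qed
  finally show ?thesis .
qed

lemma prob_\<gamma>: "prob_space \<gamma>"
proof
  have "space \<gamma> = UNIV \<times> UNIV"
    using sets_eq_imp_space_eq[OF sets_\<gamma>] by (simp add: space_pair_measure)
  then have "emeasure \<gamma> (space \<gamma>) = (\<integral>\<^sup>+x. emeasure (m x) (space (m x)) \<partial>\<nu>)"
    using emeasure_\<gamma>_rectangle[of UNIV UNIV] by (simp add: space_m)
  also have "\<dots> = 1"
    using prob_\<nu> by (simp add: prob_space.emeasure_space_1 prob_space_m)
  finally show "emeasure \<gamma> (space \<gamma>) = 1" .
qed

lemma \<gamma>_rectangle_swap:
  assumes A: "A \<in> sets borel" and B: "B \<in> sets borel"
  shows "emeasure \<gamma> (A \<times> B) = emeasure \<gamma> (B \<times> A)"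
proof -
  have AB: "A \<times> B \<in> sets (borel \<Otimes>\<^sub>M borel)" "B \<times> A \<in> sets (borel \<Otimes>\<^sub>M borel)" using A B by auto
  have "emeasure \<gamma> (A \<times> B) = (\<integral>\<^sup>+p. indicator (A \<times> B) p \<partial>\<gamma>)"
    using AB by (simp add: sets_\<gamma>)
  also have "\<dots> = (\<integral>\<^sup>+x. \<integral>\<^sup>+y. indicator (A \<times> B) (x, y) \<partial>m x \<partial>\<nu>)"
    by (rule nn_integral_\<gamma>) (use AB in simp)
  also have "\<dots> = (\<integral>\<^sup>+x. \<integral>\<^sup>+y. indicator (A \<times> B) (y, x) \<partial>m x \<partial>\<nu>)"
    using reversible AB unfolding m_reversible_def borel_prod by blast
  also have "\<dots> = (\<integral>\<^sup>+x. \<integral>\<^sup>+y. indicator (B \<times> A) (x, y) \<partial>m x \<partial>\<nu>)"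
    by (intro nn_integral_cong) (auto simp: indicator_def)
  also have "\<dots> = (\<integral>\<^sup>+p. indicator (B \<times> A) p \<partial>\<gamma>)"
    by (rule nn_integral_\<gamma>[symmetric]) (use AB in simp)
  also have "\<dots> = emeasure \<gamma> (B \<times> A)"
    using AB by (simp add: sets_\<gamma>)
  finally show ?thesis .
qed

text \<open>
  Invariance says that the average over \<open>x\<close> of \<open>m\<^sub>x(N)\<close> is \<open>\<nu>(N)\<close>, so a \<open>\<nu>\<close>-null set \<open>N\<close> is
  \<open>m\<^sub>x\<close>-null for almost every \<open>x\<close>.
\<close>

lemma AE_kernel:
  assumes "AE y in \<nu>. Q y"
  shows "AE x in \<nu>. AE y in m x. Q y"
proof -
  obtain N where N: "N \<in> null_sets \<nu>" "{y. \<not> Q y} \<subseteq> N"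
    using assms unfolding eventually_ae_filter space_\<nu> by auto
  have Nb: "N \<in> sets borel" using N(1) sets_\<nu> by auto
  have "(\<integral>\<^sup>+x. emeasure (m x) N \<partial>\<nu>) = 0"
    using invariant N(1) Nb unfolding m_invariant_def by auto
  moreover have "(\<lambda>x. emeasure (m x) N) \<in> borel_measurable \<nu>"
    using measurable_emeasure_kernel[OF kernel_measurable Nb]
    by (simp cong: measurable_cong_sets add: sets_\<nu>)
  ultimately have "AE x in \<nu>. emeasure (m x) N = 0"
    by (simp add: nn_integral_0_iff_AE)
  then show ?thesis
  proof eventually_elim
    case (elim x)
    then have "N \<in> null_sets (m x)" using Nb by (auto simp: sets_m)
    then show "AE y in m x. Q y" using N(2) unfolding eventually_ae_filter by auto
  qed
qed

section \<open>Perimeter and total variation on the edge space\<close>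

lemma main_part_borel:
  assumes "E \<in> sets (completion \<nu>)"
  shows "main_part \<nu> E \<in> sets borel" "AE x in \<nu>. x \<in> main_part \<nu> E \<longleftrightarrow> x \<in> E"
  using main_part_sets[OF assms] AE_in_main_part[OF assms] by (auto simp: sets_\<nu>)

text \<open>
  For almost every \<open>x\<close> the set \<open>- E\<close> differs from the Borel set \<open>- A\<close> by an \<open>m\<^sub>x\<close>-null set. At the
  exceptional points \<open>- E\<close> may fail to be measurable for the completion of \<open>m\<^sub>x\<close>, so the integrand
  in the perimeter has to be handled through its almost everywhere equal Borel version \<open>g\<close>.
\<close>

lemma m_perimeter_eq:
  assumes E: "E \<in> sets (completion \<nu>)" and A: "A \<in> sets borel"
    and AE: "AE x in \<nu>. x \<in> A \<longleftrightarrow> x \<in> E"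
  shows "m_perimeter m \<nu> E = measure \<gamma> (A \<times> - A)"
proof -
  have A': "- A \<in> sets borel" using A by auto
  define g where "g x = indicator A x * measure (m x) (- A)" for x
  have g[measurable]: "g \<in> borel_measurable borel"
    unfolding g_def using measurable_m[OF A'] A by measurable
  have g\<nu>: "g \<in> borel_measurable \<nu>" using g by (simp cong: measurable_cong_sets add: sets_\<nu>)
  have eq: "AE x in \<nu>. indicator E x *\<^sub>R measure (completion (m x)) (- E) = g x"
    using AE AE_kernel[OF AE]
  proof eventually_elim
    case (elim x)
    have *: "AE y in completion (m x). y \<in> - A \<longleftrightarrow> y \<in> - E"
      using elim(2) unfolding AE_completion_iff by eventually_elim auto
    have A2: "- A \<in> sets (m x)" using A' by (simp add: sets_m)
    then have A3: "- A \<in> sets (completion (m x))" by simp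
    have "- E \<in> sets (completion (m x))"
      by (rule completion.in_sets_AE[OF * A3]) (simp add: space_m)
    then have "measure (completion (m x)) (- E) = measure (completion (m x)) (- A)"
      using * A3 by (intro measure_eq_AE) auto
    then show ?case using elim(1) A2 by (simp add: g_def indicator_def)
  qed
  have "m_perimeter m \<nu> E = (\<integral>x. g x \<partial>completion \<nu>)"
    unfolding m_perimeter_def m_interaction_def set_lebesgue_integral_def
  proof (rule integral_cong_AE)
    show g': "g \<in> borel_measurable (completion \<nu>)" using g\<nu> by (rule measurable_completion)
    show AE': "AE x in completion \<nu>. indicator E x *\<^sub>R measure (completion (m x)) (- E) = g x"
      using eq by (rule AE_completion)
    show "(\<lambda>x. indicator E x *\<^sub>R measure (completion (m x)) (- E)) \<in> borel_measurable (completion \<nu>)"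
      by (rule complete_measure.borel_measurable_AE_cong[OF completion.complete_measure_axioms g' AE'])
  qed
  also have "\<dots> = (\<integral>x. g x \<partial>\<nu>)"
    using g\<nu> by (rule integral_completion)
  also have "\<dots> = enn2real (\<integral>\<^sup>+x. ennreal (g x) \<partial>\<nu>)"
    by (intro integral_eq_nn_integral AE_I2 g\<nu>) (simp add: g_def)
  also have "(\<integral>\<^sup>+x. ennreal (g x) \<partial>\<nu>) = emeasure \<gamma> (A \<times> - A)"
    unfolding emeasure_\<gamma>_rectangle[OF A A'] g_def
    using prob_space_m
    by (intro nn_integral_cong)
      (auto simp: indicator_def finite_measure.emeasure_eq_measure prob_space_def)
  finally show ?thesis by (simp add: measure_def)
qed

lemma m_perimeter_nonneg: "E \<in> sets (completion \<nu>) \<Longrightarrow> 0 \<le> m_perimeter m \<nu> E"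
  using m_perimeter_eq[OF _ main_part_borel] by simp

lemma m_perimeter_Compl:
  assumes E: "E \<in> sets (completion \<nu>)"
  shows "m_perimeter m \<nu> (- E) = m_perimeter m \<nu> E"
proof -
  let ?A = "main_part \<nu> E"
  note A = main_part_borel[OF E]
  have E': "- E \<in> sets (completion \<nu>)"
    using sets.compl_sets[OF E] by (simp add: space_\<nu> Compl_eq_Diff_UNIV)
  have "m_perimeter m \<nu> (- E) = measure \<gamma> ((- ?A) \<times> - (- ?A))"
    using A by (intro m_perimeter_eq[OF E']) auto
  also have "\<dots> = measure \<gamma> (?A \<times> - ?A)"
    using A \<gamma>_rectangle_swap[of ?A "- ?A"] by (simp add: measure_def)
  also have "\<dots> = m_perimeter m \<nu> E"
    using m_perimeter_eq[OF E A] by simp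
  finally show ?thesis .
qed

text \<open>
  The inequality holds edge by edge: an edge leaving \<open>E \<inter> F\<close> or \<open>E \<union> F\<close> leaves \<open>E\<close> or \<open>F\<close>, and one
  leaving both \<open>E \<inter> F\<close> and \<open>E \<union> F\<close> leaves both \<open>E\<close> and \<open>F\<close>.
\<close>

lemma m_perimeter_submodular:
  assumes E: "E \<in> sets (completion \<nu>)" and F: "F \<in> sets (completion \<nu>)"
  shows "m_perimeter m \<nu> (E \<inter> F) + m_perimeter m \<nu> (E \<union> F)
    \<le> m_perimeter m \<nu> E + m_perimeter m \<nu> F"
proof -
  interpret \<gamma>: prob_space \<gamma> by (rule prob_\<gamma>)
  let ?A = "main_part \<nu> E" and ?B = "main_part \<nu> F"
  note A = main_part_borel[OF E] and B = main_part_borel[OF F]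
  have rect: "S \<times> - S \<in> sets \<gamma>" if "S \<in> sets borel" for S :: "'a set"
    using that by (simp add: sets_\<gamma>)
  have eq: "measure \<gamma> (S \<times> - S) = (\<integral>p. indicator (S \<times> - S) p \<partial>\<gamma>)"
    and int: "integrable \<gamma> (indicator (S \<times> - S) :: _ \<Rightarrow> real)" if "S \<in> sets borel" for S
    using rect[OF that] sets.sets_into_space[OF rect[OF that]]
    by (auto simp: Int_absorb2 intro!: integrable_real_indicator \<gamma>.emeasure_finite simp: less_top[symmetric])
  have I: "?A \<inter> ?B \<in> sets borel" and U: "?A \<union> ?B \<in> sets borel" using A B by auto
  have "m_perimeter m \<nu> (E \<inter> F) = measure \<gamma> ((?A \<inter> ?B) \<times> - (?A \<inter> ?B))"
    using A(2) B(2) by (intro m_perimeter_eq[OF _ I]) (use E F in auto)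
  moreover have "m_perimeter m \<nu> (E \<union> F) = measure \<gamma> ((?A \<union> ?B) \<times> - (?A \<union> ?B))"
    using A(2) B(2) by (intro m_perimeter_eq[OF _ U]) (use E F in auto)
  moreover have "m_perimeter m \<nu> E = measure \<gamma> (?A \<times> - ?A)"
    and "m_perimeter m \<nu> F = measure \<gamma> (?B \<times> - ?B)"
    by (rule m_perimeter_eq[OF E A], rule m_perimeter_eq[OF F B])
  moreover have "measure \<gamma> ((?A \<inter> ?B) \<times> - (?A \<inter> ?B)) + measure \<gamma> ((?A \<union> ?B) \<times> - (?A \<union> ?B))
    \<le> measure \<gamma> (?A \<times> - ?A) + measure \<gamma> (?B \<times> - ?B)"
    unfolding eq[OF I] eq[OF U] eq[OF A(1)] eq[OF B(1)]
    unfolding Bochner_Integration.integral_add[OF int[OF I] int[OF U], symmetric]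
      Bochner_Integration.integral_add[OF int[OF A(1)] int[OF B(1)], symmetric]
    by (intro integral_mono Bochner_Integration.integrable_add int I U A B)
      (auto simp: indicator_def)
  ultimately show ?thesis by linarith
qed

lemma m_TV_eq:
  assumes u[measurable]: "u \<in> borel_measurable borel" and AE: "AE x in \<nu>. z x = u x"
  shows "m_TV m \<nu> z = (\<integral>\<^sup>+(x, y). ennreal \<bar>u y - u x\<bar> \<partial>\<gamma>) / 2"
proof -
  have "AE x in completion \<nu>. (\<integral>\<^sup>+y. ennreal \<bar>z y - z x\<bar> \<partial>completion (m x))
      = (\<integral>\<^sup>+y. ennreal \<bar>u y - u x\<bar> \<partial>m x)"
    unfolding AE_completion_iff nn_integral_completion
    using AE AE_kernel[OF AE]
  proof eventually_elim
    case (elim x)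
    from elim(2) have "AE y in m x. ennreal \<bar>z y - z x\<bar> = ennreal \<bar>u y - u x\<bar>"
      by eventually_elim (simp add: elim(1))
    then show ?case by (rule nn_integral_cong_AE)
  qed
  then have "m_TV m \<nu> z = (\<integral>\<^sup>+x. (\<integral>\<^sup>+y. ennreal \<bar>u y - u x\<bar> \<partial>m x) \<partial>\<nu>) / 2"
    unfolding m_TV_def by (subst nn_integral_cong_AE) (auto simp: nn_integral_completion)
  also have "(\<integral>\<^sup>+x. (\<integral>\<^sup>+y. ennreal \<bar>u y - u x\<bar> \<partial>m x) \<partial>\<nu>) = (\<integral>\<^sup>+(x, y). ennreal \<bar>u y - u x\<bar> \<partial>\<gamma>)"
    by (subst nn_integral_\<gamma>) auto
  finally show ?thesis .
qed

lemma borel_representative: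
  fixes z :: "'a \<Rightarrow> real"
  assumes "z \<in> borel_measurable (completion \<nu>)"
  obtains u where "u \<in> borel_measurable borel" "AE x in \<nu>. z x = u x"
  using completion_ex_borel_measurable_real[OF assms] measurable_cong_sets[OF sets_\<nu> refl]
  by blast

text \<open>
  The total variation counts edges crossing a level in both directions; by reversibility either
  direction contributes one perimeter, which accounts for the factor \<open>1/2\<close> in its definition.
\<close>

lemma ennreal_m_perimeter:
  assumes E: "E \<in> sets (completion \<nu>)" and A: "A \<in> sets borel"
    and AE: "AE x in \<nu>. x \<in> A \<longleftrightarrow> x \<in> E"
  shows "emeasure \<gamma> (A \<times> - A) + emeasure \<gamma> ((- A) \<times> A) = 2 * ennreal (m_perimeter m \<nu> E)"
proof -
  interpret \<gamma>: prob_space \<gamma> by (rule prob_\<gamma>)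
  have "emeasure \<gamma> ((- A) \<times> A) = emeasure \<gamma> (A \<times> - A)"
    using A by (intro \<gamma>_rectangle_swap) auto
  moreover have "emeasure \<gamma> (A \<times> - A) = ennreal (m_perimeter m \<nu> E)"
    unfolding m_perimeter_eq[OF assms] by (rule \<gamma>.emeasure_eq_measure)
  ultimately show ?thesis by (simp add: mult_2)
qed

lemma m_TV_indicator:
  assumes E: "E \<in> sets (completion \<nu>)" and c: "0 \<le> c"
  shows "m_TV m \<nu> (\<lambda>x. c * indicator E x) = ennreal (c * m_perimeter m \<nu> E)"
proof -
  let ?A = "main_part \<nu> E"
  note A = main_part_borel[OF E]
  have sets: "?A \<times> - ?A \<in> sets \<gamma>" "(- ?A) \<times> ?A \<in> sets \<gamma>"
    using A by (auto simp: sets_\<gamma>)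
  have "m_TV m \<nu> (\<lambda>x. c * indicator E x)
      = (\<integral>\<^sup>+(x, y). ennreal \<bar>c * indicator ?A y - c * indicator ?A x\<bar> \<partial>\<gamma>) / 2"
  proof (rule m_TV_eq)
    show "AE x in \<nu>. c * indicator E x = c * indicator ?A x"
      using A(2) by eventually_elim (auto simp: indicator_def)
  qed (use A in measurable)
  also have "(\<integral>\<^sup>+(x, y). ennreal \<bar>c * indicator ?A y - c * indicator ?A x\<bar> \<partial>\<gamma>)
      = (\<integral>\<^sup>+p. ennreal c * (indicator (?A \<times> - ?A) p + indicator ((- ?A) \<times> ?A) p) \<partial>\<gamma>)"
    using c by (intro nn_integral_cong) (auto simp: indicator_def)
  also have "\<dots> = ennreal c * (2 * ennreal (m_perimeter m \<nu> E))"
    using sets by (simp add: nn_integral_cmult nn_integral_add ennreal_m_perimeter[OF E A])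
  also have "\<dots> = 2 * ennreal (c * m_perimeter m \<nu> E)"
    using c m_perimeter_nonneg[OF E] by (simp add: ennreal_mult mult_ac)
  also have "\<dots> / 2 = ennreal (c * m_perimeter m \<nu> E)"
    by (rule ennreal_double_half)
  finally show ?thesis .
qed

text \<open>
  Coarea formula. For an edge \<open>(x, y)\<close>, \<open>\<bar>u y - u x\<bar>\<close> is the length of the set of levels \<open>t\<close> at which
  exactly one endpoint lies in \<open>{u > t}\<close>; integrating over edges first gives twice the perimeter
  of the level set.
\<close>

lemma coarea:
  assumes z: "z \<in> borel_measurable (completion \<nu>)"
  shows "m_TV m \<nu> z = (\<integral>\<^sup>+t. ennreal (m_perimeter m \<nu> {x. t < z x}) \<partial>lborel)"
proof -
  interpret \<gamma>: prob_space \<gamma> by (rule prob_\<gamma>)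
  interpret P: pair_sigma_finite "\<gamma>" "lborel :: real measure" ..
  obtain u where u[measurable]: "u \<in> borel_measurable borel" and AE: "AE x in \<nu>. z x = u x"
    using borel_representative[OF z] .
  define A where "A t = {x. t < u x}" for t
  have A: "A t \<in> sets borel" "- A t \<in> sets borel" for t unfolding A_def by measurable
  have level: "{x. t < z x} \<in> sets (completion \<nu>)" for t
    using measurable_sets[OF z, of "{t<..}"] by (simp add: vimage_def space_\<nu>)
  have perim: "emeasure \<gamma> (A t \<times> - A t) + emeasure \<gamma> ((- A t) \<times> A t)
      = 2 * ennreal (m_perimeter m \<nu> {x. t < z x})" for t
    by (rule ennreal_m_perimeter[OF level A(1)]) (use AE in \<open>eventually_elim, auto simp: A_def\<close>)
  define f :: "'a \<times> 'a \<Rightarrow> real \<Rightarrow> ennreal"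
    where "f p t = indicator (A t \<times> - A t) p + indicator ((- A t) \<times> A t) p" for p t
  have f_alt: "f p t = (if min (u (fst p)) (u (snd p)) \<le> t \<and> t < max (u (fst p)) (u (snd p))
      then 1 else 0)" for p t
    by (cases p) (auto simp: f_def A_def indicator_def)
  have fm: "case_prod f \<in> borel_measurable (\<gamma> \<Otimes>\<^sub>M lborel)"
  proof -
    have "case_prod f \<in> borel_measurable ((borel \<Otimes>\<^sub>M borel) \<Otimes>\<^sub>M borel)"
      unfolding f_alt by measurable
    then show ?thesis
      by (simp cong: measurable_cong_sets sets_pair_measure_cong add: sets_\<gamma>)
  qed
  have over_t: "(\<integral>\<^sup>+t. f p t \<partial>lborel) = (case p of (x, y) \<Rightarrow> ennreal \<bar>u y - u x\<bar>)" for p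
  proof -
    obtain x y where p: "p = (x, y)" by fastforce
    have "f p = indicator {min (u x) (u y)..<max (u x) (u y)}"
      by (auto simp: f_alt p indicator_def fun_eq_iff)
    then have "(\<integral>\<^sup>+t. f p t \<partial>lborel) = emeasure lborel {min (u x) (u y)..<max (u x) (u y)}"
      by simp
    also have "\<dots> = ennreal \<bar>u y - u x\<bar>"
      by (auto simp: emeasure_lborel_Ico_eq min_def max_def)
    finally show ?thesis by (simp add: p)
  qed
  have over_edges: "(\<integral>\<^sup>+p. f p t \<partial>\<gamma>) = 2 * ennreal (m_perimeter m \<nu> {x. t < z x})" for t
    unfolding f_def perim[symmetric] using A
    by (subst nn_integral_add) (auto simp: sets_\<gamma> intro!: borel_measurable_indicator)
  have "2 * m_TV m \<nu> z = (\<integral>\<^sup>+p. (\<integral>\<^sup>+t. f p t \<partial>lborel) \<partial>\<gamma>)"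
    unfolding m_TV_eq[OF u AE] over_t
    by (simp add: ennreal_times_divide ennreal_double_half)
  also have "\<dots> = (\<integral>\<^sup>+t. (\<integral>\<^sup>+p. f p t \<partial>\<gamma>) \<partial>lborel)"
    by (rule P.Fubini'[OF fm, symmetric])
  also have "\<dots> = (\<integral>\<^sup>+t. 2 * ennreal (m_perimeter m \<nu> {x. t < z x}) \<partial>lborel)"
    by (simp add: over_edges)
  also have "\<dots> = 2 * (\<integral>\<^sup>+t. ennreal (m_perimeter m \<nu> {x. t < z x}) \<partial>lborel)"
  proof (rule nn_integral_cmult)
    have "(\<lambda>t. (\<integral>\<^sup>+p. f p t \<partial>\<gamma>) / 2) \<in> borel_measurable lborel"
      using fm by measurable
    then show "(\<lambda>t. ennreal (m_perimeter m \<nu> {x. t < z x})) \<in> borel_measurable lborel"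
      by (simp add: over_edges ennreal_double_half)
  qed
  finally show ?thesis by (simp add: ennreal_mult_cancel_left)
qed

text \<open>
  A mean zero function that satisfies the subgradient inequality on indicators of sets satisfies it
  on all functions: integrate the inequality for \<open>E = {z > t}\<close> over \<open>t\<close>.
\<close>

lemma integral_le_m_TV:
  assumes w: "w \<in> borel_measurable (completion \<nu>)" and bound: "\<And>x. \<bar>w x\<bar> \<le> C"
    and mean: "(\<integral>x. w x \<partial>completion \<nu>) = 0"
    and levels: "\<And>E. E \<in> sets (completion \<nu>) \<Longrightarrow>
      (\<integral>x. w x * indicator E x \<partial>completion \<nu>) \<le> m_perimeter m \<nu> E"
    and z: "integrable (completion \<nu>) z"
  shows "ennreal (\<integral>x. w x * z x \<partial>completion \<nu>) \<le> m_TV m \<nu> z"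
proof -
  let ?\<phi> = "\<lambda>t. \<integral>x. w x * indicator {x. t < z x} x \<partial>completion \<nu>"
  have fin: "finite_measure (completion \<nu>)"
    using prob_completion by (simp add: prob_space_def)
  note cake = signed_layer_cake[OF fin z w bound mean]
  have zm: "z \<in> borel_measurable (completion \<nu>)" using z by simp
  have level: "{x. t < z x} \<in> sets (completion \<nu>)" for t
    using measurable_sets[OF zm, of "{t<..}"] by (simp add: vimage_def space_\<nu>)
  have "ennreal (\<integral>x. w x * z x \<partial>completion \<nu>) \<le> (\<integral>\<^sup>+t. ennreal (?\<phi> t) \<partial>lborel)"
    using integral_le_nn_integral[OF cake(1)] cake(2) by simp
  also have "\<dots> \<le> (\<integral>\<^sup>+t. ennreal (m_perimeter m \<nu> {x. t < z x}) \<partial>lborel)"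
    by (intro nn_integral_mono ennreal_leI levels level)
  finally show ?thesis unfolding coarea[OF zm] .
qed

section \<open>Calibrable sets and eigenpairs\<close>

lemma m_calibrable_le:
  assumes "m_calibrable m \<nu> D" "E \<subseteq> D" and E: "E \<in> sets (completion \<nu>)"
  shows "m_ratio m \<nu> D * measure (completion \<nu>) E \<le> m_perimeter m \<nu> E"
proof (cases "measure (completion \<nu>) E > 0")
  case True
  have "m_ratio m \<nu> D = Inf {m_perimeter m \<nu> E / measure (completion \<nu>) E | E.
      E \<subseteq> D \<and> E \<in> sets (completion \<nu>) \<and> measure (completion \<nu>) E > 0}"
    using assms(1) by (simp add: m_calibrable_def)
  also have "\<dots> \<le> m_perimeter m \<nu> E / measure (completion \<nu>) E"
    by (rule cInf_lower)
      (use assms(2) E True in \<open>auto intro!: bdd_belowI[of _ 0] divide_nonneg_pos m_perimeter_nonneg\<close>)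
  finally have "m_ratio m \<nu> D \<le> m_perimeter m \<nu> E / measure (completion \<nu>) E" .
  then show ?thesis using True by (simp add: pos_le_divide_eq)
next
  case False
  then have "measure (completion \<nu>) E = 0"
    using measure_nonneg[of "completion \<nu>" E] by linarith
  then show ?thesis using m_perimeter_nonneg[OF E] by simp
qed

lemma m_calibrableI:
  assumes D: "D \<in> sets (completion \<nu>)" "0 < measure (completion \<nu>) D" "measure (completion \<nu>) D < 1"
    and le: "\<And>E. E \<subseteq> D \<Longrightarrow> E \<in> sets (completion \<nu>) \<Longrightarrow> measure (completion \<nu>) E > 0 \<Longrightarrow>
      m_ratio m \<nu> D * measure (completion \<nu>) E \<le> m_perimeter m \<nu> E"
  shows "m_calibrable m \<nu> D"
  unfolding m_calibrable_def
proof (intro conjI D)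
  show "m_ratio m \<nu> D = Inf {m_perimeter m \<nu> E / measure (completion \<nu>) E | E.
      E \<subseteq> D \<and> E \<in> sets (completion \<nu>) \<and> measure (completion \<nu>) E > 0}"
    by (rule cInf_eq_minimum[symmetric])
      (use D le in \<open>auto simp: m_ratio_def pos_le_divide_eq\<close>)
qed

lemma m_cheeger_le:
  assumes "E \<in> sets (completion \<nu>)" "measure (completion \<nu>) E \<le> 1 / 2"
  shows "m_cheeger m \<nu> * measure (completion \<nu>) E \<le> m_perimeter m \<nu> E"
proof (cases "measure (completion \<nu>) E > 0")
  case True
  have "m_cheeger m \<nu> \<le> m_perimeter m \<nu> E / measure (completion \<nu>) E"
    unfolding m_cheeger_def
    by (rule cInf_lower)
      (use assms True in \<open>auto intro!: bdd_belowI[of _ 0] divide_nonneg_pos m_perimeter_nonneg\<close>)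
  then show ?thesis using True by (simp add: pos_le_divide_eq)
next
  case False
  then have "measure (completion \<nu>) E = 0"
    using measure_nonneg[of "completion \<nu>" E] by linarith
  then show ?thesis using m_perimeter_nonneg[OF assms(1)] by simp
qed

lemma prob_completion_Compl:
  assumes "E \<in> sets (completion \<nu>)"
  shows "- E \<in> sets (completion \<nu>)" "measure (completion \<nu>) (- E) = 1 - measure (completion \<nu>) E"
  using sets.compl_sets[OF assms] prob_space.prob_compl[OF prob_completion assms]
  by (simp_all add: space_\<nu> Compl_eq_Diff_UNIV)

text \<open>
  For subsets of measure at most \<open>1/2\<close> the Cheeger inequality applies directly, as the ratio \<open>\<lambda>\<close> of
  \<open>\<Omega>\<close> is at least that of \<open>- \<Omega>\<close>. Subsets \<open>E\<close> of \<open>- \<Omega>\<close> with larger measure are tested through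
  their complement: with \<open>\<omega> = \<nu>(\<Omega>)\<close> and \<open>e = \<nu>(E) \<le> 1 - \<omega>\<close> they satisfy
  \<open>P(E) = P(- E) \<ge> \<lambda> (1 - e) \<ge> \<lambda> e \<omega> / (1 - \<omega>)\<close>, and \<open>\<lambda> \<omega> / (1 - \<omega>)\<close> is the ratio of \<open>- \<Omega>\<close>.
\<close>

lemma cheeger_set_calibrable:
  assumes \<Omega>: "\<Omega> \<in> sets (completion \<nu>)" "0 < measure (completion \<nu>) \<Omega>"
      "measure (completion \<nu>) \<Omega> \<le> 1 / 2"
    and h: "m_cheeger m \<nu> = m_ratio m \<nu> \<Omega>"
  shows "m_calibrable m \<nu> \<Omega>" and "m_calibrable m \<nu> (- \<Omega>)"
proof -
  interpret prob_space "completion \<nu>" by (rule prob_completion)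
  let ?\<mu> = "measure (completion \<nu>)"
  note \<Omega>' = prob_completion_Compl[OF \<Omega>(1)]
  show "m_calibrable m \<nu> \<Omega>"
  proof (rule m_calibrableI)
    fix E assume E: "E \<subseteq> \<Omega>" "E \<in> sets (completion \<nu>)"
    have "?\<mu> E \<le> ?\<mu> \<Omega>" using E \<Omega> by (intro finite_measure_mono) auto
    then show "m_ratio m \<nu> \<Omega> * ?\<mu> E \<le> m_perimeter m \<nu> E"
      using m_cheeger_le[OF E(2)] \<Omega>(3) h by simp
  qed (use \<Omega> in simp_all)
  show "m_calibrable m \<nu> (- \<Omega>)"
  proof (rule m_calibrableI)
    fix E assume E: "E \<subseteq> - \<Omega>" "E \<in> sets (completion \<nu>)"
    have nn: "0 \<le> m_ratio m \<nu> \<Omega>"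
      using \<Omega> m_perimeter_nonneg by (simp add: m_ratio_def)
    have le: "?\<mu> E \<le> 1 - ?\<mu> \<Omega>"
      using E \<Omega>' finite_measure_mono[of E "- \<Omega>"] by simp
    have eq: "m_ratio m \<nu> (- \<Omega>) = m_ratio m \<nu> \<Omega> * (?\<mu> \<Omega> / (1 - ?\<mu> \<Omega>))"
      using \<Omega>(2) by (simp add: m_ratio_def m_perimeter_Compl[OF \<Omega>(1)] \<Omega>'(2))
    show "m_ratio m \<nu> (- \<Omega>) * ?\<mu> E \<le> m_perimeter m \<nu> E"
    proof (cases "?\<mu> E \<le> 1 / 2")
      case True
      have "?\<mu> \<Omega> / (1 - ?\<mu> \<Omega>) \<le> 1" using \<Omega> by simp
      then have "m_ratio m \<nu> (- \<Omega>) \<le> m_ratio m \<nu> \<Omega>"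
        unfolding eq using nn by (rule mult_left_le)
      then have "m_ratio m \<nu> (- \<Omega>) * ?\<mu> E \<le> m_ratio m \<nu> \<Omega> * ?\<mu> E"
        by (rule mult_right_mono) simp
      then show ?thesis using m_cheeger_le[OF E(2) True] h by simp
    next
      case False
      note E' = prob_completion_Compl[OF E(2)]
      \<comment> \<open>The difference of the two sides is \<open>1 - \<mu> \<Omega> - \<mu> E\<close>.\<close>
      have "?\<mu> \<Omega> * ?\<mu> E \<le> (1 - ?\<mu> E) * (1 - ?\<mu> \<Omega>)"
        using le by (simp add: algebra_simps)
      then have "?\<mu> \<Omega> / (1 - ?\<mu> \<Omega>) * ?\<mu> E \<le> 1 - ?\<mu> E"
        using \<Omega> by (simp add: pos_divide_le_eq)
      then have "m_ratio m \<nu> (- \<Omega>) * ?\<mu> E \<le> m_ratio m \<nu> \<Omega> * ?\<mu> (- E)"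
        unfolding eq E'(2) mult.assoc using nn by (rule mult_left_mono)
      also have "\<dots> \<le> m_perimeter m \<nu> (- E)"
        using m_cheeger_le[OF E'(1)] E'(2) False h by simp
      finally show ?thesis using m_perimeter_Compl[OF E(2)] by simp
    qed
  qed (use \<Omega>(2,3) \<Omega>'(2) in \<open>simp_all add: \<Omega>'(1)\<close>)
qed

text \<open>
  This is \<open>\<integral>\<^sub>E w d\<nu> \<le> P(E)\<close> for the weight \<open>w\<close> equal to \<open>\<lambda>\<close> on \<open>\<Omega>\<close> and \<open>-\<lambda>'\<close> off \<open>\<Omega>\<close>. Testing the
  calibrability of \<open>\<Omega>\<close> with \<open>E \<inter> \<Omega>\<close> controls the positive part. The negative part is controlled by
  testing \<open>- \<Omega>\<close> with \<open>- (E \<union> \<Omega>)\<close>, whose perimeter is that of \<open>E \<union> \<Omega>\<close>; submodularity joins the two bounds.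
\<close>

lemma calibrable_weight_le_perimeter:
  assumes cal: "m_calibrable m \<nu> \<Omega>" "m_calibrable m \<nu> (- \<Omega>)"
    and E: "E \<in> sets (completion \<nu>)"
  shows "m_ratio m \<nu> \<Omega> * measure (completion \<nu>) (E \<inter> \<Omega>)
      - m_ratio m \<nu> (- \<Omega>) * measure (completion \<nu>) (E - \<Omega>) \<le> m_perimeter m \<nu> E"
proof -
  interpret prob_space "completion \<nu>" by (rule prob_completion)
  let ?\<mu> = "measure (completion \<nu>)"
  have \<Omega>: "\<Omega> \<in> sets (completion \<nu>)" "- \<Omega> \<in> sets (completion \<nu>)" "?\<mu> (- \<Omega>) \<noteq> 0"
    using cal by (auto simp: m_calibrable_def)
  have U: "E \<union> \<Omega> \<in> sets (completion \<nu>)" using E \<Omega> by auto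
  have in_\<Omega>: "m_ratio m \<nu> \<Omega> * ?\<mu> (E \<inter> \<Omega>) \<le> m_perimeter m \<nu> (E \<inter> \<Omega>)"
    using E \<Omega> by (intro m_calibrable_le cal) auto
  have "m_ratio m \<nu> (- \<Omega>) * ?\<mu> (- (E \<union> \<Omega>)) \<le> m_perimeter m \<nu> (- (E \<union> \<Omega>))"
    using prob_completion_Compl[OF U] by (intro m_calibrable_le cal) auto
  moreover have "?\<mu> (- (E \<union> \<Omega>)) = ?\<mu> (- \<Omega>) - ?\<mu> (E - \<Omega>)"
  proof -
    have "- (E \<union> \<Omega>) = - \<Omega> - (E - \<Omega>)" by auto
    then show ?thesis
      using finite_measure_Diff[of "- \<Omega>" "E - \<Omega>"] E \<Omega> by auto
  qed
  moreover have "m_ratio m \<nu> (- \<Omega>) * ?\<mu> (- \<Omega>) = m_perimeter m \<nu> \<Omega>"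
    using \<Omega> by (simp add: m_ratio_def m_perimeter_Compl)
  ultimately have "m_perimeter m \<nu> \<Omega> - m_ratio m \<nu> (- \<Omega>) * ?\<mu> (E - \<Omega>) \<le> m_perimeter m \<nu> (E \<union> \<Omega>)"
    using m_perimeter_Compl[OF U] by (simp add: right_diff_distrib)
  then show ?thesis
    using in_\<Omega> m_perimeter_submodular[OF E \<Omega>(1)] by linarith
qed

text \<open>
  The function \<open>w = \<lambda> \<xi>\<close> is a subgradient because \<open>\<integral> w z d\<nu> \<le> TV(z)\<close> for all \<open>z\<close>, with equality at the
  normalized indicator of \<open>\<Omega>\<close>. Among constants, the value \<open>- r\<close> of \<open>\<xi>\<close> off \<open>\<Omega>\<close> is forced by the
  mean zero condition, and \<open>r \<le> 1\<close> is where \<open>\<nu>(\<Omega>) \<le> 1/2\<close> enters.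
\<close>

lemma calibrable_imp_eigenpair:
  assumes half: "measure (completion \<nu>) \<Omega> \<le> 1 / 2"
    and cal: "m_calibrable m \<nu> \<Omega>" "m_calibrable m \<nu> (- \<Omega>)"
  shows "m_eigenpair m \<nu> (m_ratio m \<nu> \<Omega>) (\<lambda>x. 1 / measure (completion \<nu>) \<Omega> * indicator \<Omega> x)"
proof -
  interpret prob_space "completion \<nu>" by (rule prob_completion)
  let ?\<mu> = "measure (completion \<nu>)"
  have \<Omega>[measurable]: "\<Omega> \<in> sets (completion \<nu>)" and pos: "0 < ?\<mu> \<Omega>"
    using cal by (auto simp: m_calibrable_def)
  note \<Omega>' = prob_completion_Compl[OF \<Omega>]
  define c where "c = 1 / ?\<mu> \<Omega>"
  define a where "a = m_ratio m \<nu> \<Omega>"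
  define b where "b = m_ratio m \<nu> (- \<Omega>)"
  define r where "r = ?\<mu> \<Omega> / (1 - ?\<mu> \<Omega>)"
  define \<xi> :: "'a \<Rightarrow> real" where "\<xi> x = (if x \<in> \<Omega> then 1 else - r)" for x
  define w where "w x = a * \<xi> x" for x
  define u where "u x = c * indicator \<Omega> x" for x
  have c: "0 < c" using pos by (simp add: c_def)
  have r: "0 \<le> r" "r \<le> 1" using half pos by (auto simp: r_def)
  have ab: "b = a * r" and a_eq: "a = c * m_perimeter m \<nu> \<Omega>"
    using half pos \<Omega>' by (auto simp: a_def b_def r_def c_def m_ratio_def m_perimeter_Compl[OF \<Omega>])
  have a0: "0 \<le> a" using m_perimeter_nonneg[OF \<Omega>] c by (simp add: a_eq)
  have w_alt: "w x = a * indicator \<Omega> x - b * indicator (- \<Omega>) x" for x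
    by (simp add: w_def \<xi>_def ab indicator_def)
  have wm[measurable]: "w \<in> borel_measurable (completion \<nu>)"
    unfolding w_def \<xi>_def by measurable
  have um[measurable]: "u \<in> borel_measurable (completion \<nu>)"
    unfolding u_def by measurable
  have w_bound: "\<bar>w x\<bar> \<le> a" for x
    using a0 r by (auto simp: w_def \<xi>_def abs_mult mult_left_le)
  have on_sets: "(\<integral>x. w x * indicator E x \<partial>completion \<nu>) = a * ?\<mu> (E \<inter> \<Omega>) - b * ?\<mu> (E - \<Omega>)"
    if E: "E \<in> sets (completion \<nu>)" for E
  proof -
    have "(\<integral>x. w x * indicator E x \<partial>completion \<nu>)
        = (\<integral>x. a * indicator (E \<inter> \<Omega>) x - b * indicator (E - \<Omega>) x \<partial>completion \<nu>)"
      by (intro Bochner_Integration.integral_cong) (auto simp: w_alt indicator_def)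
    also have "\<dots> = a * ?\<mu> (E \<inter> \<Omega>) - b * ?\<mu> (E - \<Omega>)"
      using E by (subst Bochner_Integration.integral_diff)
        (auto intro!: integrable_mult_right integrable_real_indicator simp: less_top[symmetric] space_\<nu>
          simp del: emeasure_completion)
    finally show ?thesis .
  qed
  have mean: "(\<integral>x. w x \<partial>completion \<nu>) = 0"
    using on_sets[of UNIV] \<Omega>' half sets.top[of "completion \<nu>"]
    by (simp add: space_\<nu> Compl_eq_Diff_UNIV[symmetric] ab r_def)
  have wu: "(\<integral>x. w x * u x \<partial>completion \<nu>) = a"
    using on_sets[OF \<Omega>] pos by (simp add: u_def mult.left_commute c_def)
  have L2: "v \<in> L2_fun \<nu>" if [measurable]: "v \<in> borel_measurable (completion \<nu>)"
    and "\<And>x. \<bar>v x\<bar> \<le> C" for v and C :: real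
  proof -
    have "\<bar>v x\<bar>\<^sup>2 \<le> C\<^sup>2" for x using that(2) by (intro power_mono) auto
    then have "integrable (completion \<nu>) (\<lambda>x. (v x)\<^sup>2)"
      by (intro integrable_const_bound[of _ "C\<^sup>2"]) auto
    then show ?thesis by (simp add: L2_fun_def)
  qed
  have wL2: "w \<in> L2_fun \<nu>" by (rule L2[OF wm w_bound])
  have uL2: "u \<in> L2_fun \<nu>" by (rule L2[OF um, of c]) (use c in \<open>auto simp: u_def indicator_def\<close>)
  have TVu: "m_TV m \<nu> u = ennreal a"
    unfolding u_def a_eq by (rule m_TV_indicator[OF \<Omega>]) (use c in simp)
  have "w \<in> m_subdiff m \<nu> u"
    unfolding m_subdiff_def
  proof (intro CollectI conjI ballI uL2 wL2)
    show "m_TV m \<nu> u < \<infinity>" by (simp add: TVu)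
    fix z assume z: "z \<in> L2_fun \<nu>"
    note zi = L2_fun_integrable[OF prob_\<nu> z] and ui = L2_fun_integrable[OF prob_\<nu> uL2]
    have wi: "integrable (completion \<nu>) (\<lambda>x. w x * v x)" if "integrable (completion \<nu>) v" for v
      by (rule Bochner_Integration.integrable_bound[of _ "\<lambda>x. a * v x"])
        (use that w_bound a0 in \<open>auto simp: abs_mult intro!: mult_right_mono\<close>)
    let ?I = "\<integral>x. w x * z x \<partial>completion \<nu>"
    have "(\<integral>x. w x * (z x - u x) \<partial>completion \<nu>) = ?I - a"
      using wi[OF zi] wi[OF ui] by (simp add: right_diff_distrib wu)
    then have "enn2ereal (m_TV m \<nu> u) + ereal (\<integral>x. w x * (z x - u x) \<partial>completion \<nu>) = ereal ?I"
      using a0 by (simp add: TVu enn2ereal_ennreal)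
    also have "\<dots> \<le> enn2ereal (ennreal ?I)"
      by (cases "0 \<le> ?I") (auto simp: enn2ereal_ennreal ennreal_neg zero_ennreal.rep_eq)
    also have "\<dots> \<le> enn2ereal (m_TV m \<nu> z)"
      using integral_le_m_TV[OF wm w_bound mean _ zi] on_sets
        calibrable_weight_le_perimeter[OF cal]
      by (simp add: a_def b_def less_eq_ennreal.rep_eq[symmetric])
    finally show "enn2ereal (m_TV m \<nu> u) + ereal (\<integral>x. w x * (z x - u x) \<partial>completion \<nu>)
        \<le> enn2ereal (m_TV m \<nu> z)" .
  qed
  then have "(\<lambda>x. - (a * \<xi> x)) \<in> m_laplace1 m \<nu> u"
    by (simp add: m_laplace1_def w_def[abs_def])
  moreover have "\<xi> x \<in> multi_sign (u x)" for x
    using c r by (auto simp: \<xi>_def multi_sign_def u_def)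
  moreover have "(\<integral>x. \<bar>u x\<bar> \<partial>completion \<nu>) = 1"
    using c pos by (simp add: u_def abs_mult c_def space_\<nu>)
  ultimately have "m_eigenpair m \<nu> a u"
    unfolding m_eigenpair_def using uL2 by (intro conjI exI[of _ \<xi>] allI)
  then show ?thesis by (simp only: a_def u_def[abs_def] c_def)
qed

end

theorem theorem6p16:
  fixes m :: "'a::polish_space \<Rightarrow> 'a measure" and \<nu> :: "'a measure" and \<Omega> :: "'a set"
  assumes "reversible_random_walk m \<nu>"
    and "\<Omega> \<in> sets (completion \<nu>)"
    and "0 < measure (completion \<nu>) \<Omega>"
    and "measure (completion \<nu>) \<Omega> \<le> 1 / 2"
  shows "(m_calibrable m \<nu> \<Omega> \<and> m_calibrable m \<nu> (- \<Omega>) \<longrightarrow>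
            m_eigenpair m \<nu> (m_ratio m \<nu> \<Omega>)
              (\<lambda>x. 1 / measure (completion \<nu>) \<Omega> * indicator \<Omega> x)) \<and>
         (m_cheeger m \<nu> = m_ratio m \<nu> \<Omega> \<longrightarrow>
            m_calibrable m \<nu> \<Omega> \<and> m_calibrable m \<nu> (- \<Omega>)) \<and>
         (m_cheeger m \<nu> = m_ratio m \<nu> \<Omega> \<longrightarrow>
            m_eigenpair m \<nu> (m_ratio m \<nu> \<Omega>)
              (\<lambda>x. 1 / measure (completion \<nu>) \<Omega> * indicator \<Omega> x))"
proof -
  interpret reversible_random_walk m \<nu> by (rule assms(1))
  note cheeger = cheeger_set_calibrable[OF assms(2-4)]
    and eigen = calibrable_imp_eigenpair[OF assms(4)]
  show ?thesis using cheeger eigen by blast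
qed

end
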